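(* Let $F:\mathbb{T}\to\mathbb{C}$ be a continuous function with modulus of continuity $\lambda(F,\delta)=o(\delta^{1/2})$ as $\delta\to 0$. Let $p(n)$ and $q(n)$ be two nondecreasing sequences of nonnegative integers such that $p(n)+q(n)=n-1$ and $\lim_{n\to\infty}\frac{p(n)}{n-1}=r$ with $0<r<1$. For each $n$ let $\{z_j\}_{j=1}^n=\{z_{j,n}\}_{j=1}^n$ be a set of complex numbers (depending on $n$) with $|z_j|=1$ for all $j=1,\dots,n$ and $z_i\neq z_j$ for $i\neq j$, and let $W_n(z)=\prod_{j=1}^n(z-z_j)$. Assume that there exist positive constants $B$ and $L$ (independent of $n$ and $z$) such that for all $n$ large enough and every $z\in\mathbb{T}$: (i) $B\le \dfrac{|W_n'(z)|}{n}$; (ii) $\dfrac{|W_n(z)|^2}{n^2}\displaystyle\sum_{j=1}^n\frac{1}{|z-z_j|^2}\le L$. Let $L_{-p(n),q(n)}(F;z)\in\Lambda_{-p(n),q(n)}$ be the unique Laurent polynomial in this space satisfying $L_{-p(n),q(n)}(F;z_j)=F(z_j)$ for $j=1,\dots,n$. Then $\lim_{n\to\infty}L_{-p(n),q(n)}(F;z)=F(z)$ uniformly on $\mathbb{T}$.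
   Context: $\mathbb{T}=\{z\in\mathbb{C}:|z|=1\}$. For nonnegative integers $p,q$, $\Lambda_{-p,q}=\operatorname{span}\{z^k:-p\le k\le q\}$ (complex Laurent polynomials). The modulus of continuity of $F$ on $\mathbb{T}$ is $\lambda(F,\delta)=\sup\{|F(z_1)-F(z_2)|: z_1,z_2\in\mathbb{T},\ |z_1-z_2|<\delta\}$. In (ii), each term $|W_n(z)|^2/|z-z_j|^2$ is understood as $|W_n(z)/(z-z_j)|^2$, where $W_n(z)/(z-z_j)$ is a polynomial, so that it makes sense also at $z=z_j$. *)

theory Defs
  imports
    "HOL-Analysis.Analysis"
    "HOL-Computational_Algebra.Polynomial"
    "HOL-Library.Landau_Symbols"
begin

abbreviation unit_circle :: "complex set" where
  "unit_circle \<equiv> sphere 0 1"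

text \<open>The set below is nonempty for \<open>\<delta> > 0\<close>, and bounded above when \<open>F\<close> is continuous on the
  circle, so that the real-valued supremum is then the intended one.\<close>

definition modulus_of_continuity :: "(complex \<Rightarrow> complex) \<Rightarrow> real \<Rightarrow> real" where
  "modulus_of_continuity F \<delta> =
     Sup {cmod (F z1 - F z2) | z1 z2. z1 \<in> unit_circle \<and> z2 \<in> unit_circle \<and> cmod (z1 - z2) < \<delta>}"

text \<open>Laurent polynomials are represented as functions. The value at \<open>0\<close> is irrelevant: it is the
  coefficient of index \<open>0\<close>, since \<open>0 powi k = 0\<close> for \<open>k \<noteq> 0\<close>, so that a function in this
  set still corresponds to exactly one Laurent polynomial.\<close>

definition laurent_space :: "nat \<Rightarrow> nat \<Rightarrow> (complex \<Rightarrow> complex) set" where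
  "laurent_space p q =
     {P. \<exists>c :: int \<Rightarrow> complex. P = (\<lambda>z. \<Sum>k = - int p..int q. c k * z powi k)}"

definition laurent_interpolant ::
  "nat \<Rightarrow> nat \<Rightarrow> nat \<Rightarrow> (nat \<Rightarrow> complex) \<Rightarrow> (complex \<Rightarrow> complex) \<Rightarrow> complex \<Rightarrow> complex" where
  "laurent_interpolant p q n z F =
     (THE P. P \<in> laurent_space p q \<and> (\<forall>j\<in>{1..n}. P (z j) = F (z j)))"

definition nodal_poly :: "nat \<Rightarrow> (nat \<Rightarrow> complex) \<Rightarrow> complex poly" where
  "nodal_poly n z = (\<Prod>j = 1..n. [:- z j, 1:])"

end

theory Submission
  imports Defs
begin

text \<open>Let \<open>m\<close> be half of \<open>min (p n) (q n)\<close>, which is of order \<open>n\<close> because \<open>0 < r < 1\<close>. Averaging \<open>F\<close>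
  against the Jackson kernel \<open>|1 + u + \<dots> + u ^ (m - 1)| ^ 4\<close>, whose second moment is at most
  \<open>12 / m\<^sup>2\<close>, gives a Laurent polynomial \<open>R\<close> in the interpolation space at distance
  \<open>E = o(n powr (-1/2))\<close> from \<open>F\<close>. Interpolation reproduces \<open>R\<close>, and by Cauchy-Schwarz and the two
  conditions on the nodes its operator norm is at most \<open>sqrt n * sqrt L / B\<close>; hence the
  interpolation error is at most \<open>E * (1 + sqrt n * sqrt L / B)\<close>, which tends to \<open>0\<close>.\<close>

section \<open>Orthogonality of roots of unity and the discrete Parseval identity\<close>

lemma mult_cnj_unit: "cmod u = 1 \<Longrightarrow> u * cnj u = 1"
  by (metis complex_norm_square of_real_1 power_one)

text \<open>The base of this geometric sum is an \<open>N\<close>-th root of unity, and it differs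
  from 1 because distinct exponents below \<open>N\<close> give distinct powers of
  \<open>w\<close>.\<close>

lemma sum_root_unity_powers:
  fixes N i j :: nat
  assumes "i < N" "j < N" "i \<noteq> j"
  defines "w \<equiv> cis (2 * pi / real N)"
  shows "(\<Sum>k<N. (w ^ i * cnj (w ^ j)) ^ k) = 0"
proof -
  have N: "N > 0" using assms by simp
  define y where "y = w ^ i * cnj (w ^ j)"
  have nw: "cmod (w ^ j) = 1" by (simp add: w_def norm_power)
  have "w ^ N = cis (real N * (2 * pi / real N))" unfolding w_def by (rule Complex.DeMoivre)
  hence wN: "w ^ N = 1" using N by simp
  have "y ^ N = (w ^ N) ^ i * cnj ((w ^ N) ^ j)"
    by (simp add: y_def power_mult_distrib flip: power_mult) (simp add: mult.commute)
  hence yN: "y ^ N = 1" by (simp add: wN)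
  have "y \<noteq> 1"
  proof
    assume y: "y = 1"
    have "w ^ j * cnj (w ^ j) = 1" using nw by (rule mult_cnj_unit)
    hence "w ^ i = y * w ^ j" by (simp add: y_def algebra_simps del: complex_cnj_power)
    hence "w ^ i = w ^ j" using y by simp
    hence "cis (2 * pi * real i / real N) = cis (2 * pi * real j / real N)"
      by (simp add: w_def Complex.DeMoivre mult_ac)
    moreover have "inj_on (\<lambda>k. cis (2 * pi * real k / real N)) {..<N}"
      using Complex.bij_betw_roots_unity[OF N] by (simp add: bij_betw_def)
    ultimately show False using assms by (auto dest: inj_onD)
  qed
  hence "(\<Sum>k<N. y ^ k) = 0" using yN by (simp add: sum_gp_strict)
  thus ?thesis unfolding y_def .
qed

text \<open>Expanding the squares leaves only the diagonal, since \<open>degree P < N\<close> keeps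
  all exponents distinct modulo \<open>N\<close>. The grid is rotated by \<open>x\<close> because
  the kernel will be sampled relative to an arbitrary point of the circle; the rotation multiplies
  each coefficient by a unimodular number.\<close>

lemma discrete_parseval:
  fixes P :: "complex poly" and x :: complex
  assumes "degree P < N" "cmod x = 1"
  defines "w \<equiv> cis (2 * pi / real N)"
  shows "(\<Sum>k<N. (cmod (poly P (x * w ^ k)))\<^sup>2) = real N * (\<Sum>i<N. (cmod (coeff P i))\<^sup>2)"
proof -
  have pP: "poly P y = (\<Sum>i<N. coeff P i * y ^ i)" for y
    unfolding poly_altdef using assms
    by (intro sum.mono_neutral_left) (auto simp: coeff_eq_0 not_le)
  have nx: "x ^ i * cnj (x ^ i) = 1" for i
    using assms by (intro mult_cnj_unit) (simp add: norm_power)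
  have "complex_of_real (\<Sum>k<N. (cmod (poly P (x * w ^ k)))\<^sup>2)
      = (\<Sum>k<N. poly P (x * w ^ k) * cnj (poly P (x * w ^ k)))"
    by (simp only: of_real_sum complex_norm_square)
  also have "\<dots> = (\<Sum>k<N. \<Sum>i<N. \<Sum>j<N. (coeff P i * cnj (coeff P j) * x ^ i * cnj (x ^ j))
      * (w ^ i * cnj (w ^ j)) ^ k)"
    unfolding pP cnj_sum sum_product
    by (intro sum.cong refl) (simp add: power_mult_distrib mult_ac flip: power_mult)
  also have "\<dots> = (\<Sum>i<N. \<Sum>j<N. (coeff P i * cnj (coeff P j) * x ^ i * cnj (x ^ j))
      * (\<Sum>k<N. (w ^ i * cnj (w ^ j)) ^ k))"
    unfolding sum_distrib_left by (rule trans[OF sum.swap], rule sum.cong[OF refl], rule sum.swap)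
  also have "\<dots> = (\<Sum>i<N. \<Sum>j<N. if i = j then complex_of_real (real N * (cmod (coeff P i))\<^sup>2) else 0)"
  proof (intro sum.cong refl, goal_cases)
    case (1 i j)
    show ?case
    proof (cases "i = j")
      case True
      have "w ^ i * cnj (w ^ i) = 1"
        by (intro mult_cnj_unit) (simp add: norm_power w_def)
      hence "(\<Sum>k<N. (w ^ i * cnj (w ^ j)) ^ k) = of_nat N" using True by simp
      moreover have "coeff P i * cnj (coeff P j) * x ^ i * cnj (x ^ j) = (cmod (coeff P i))\<^sup>2"
        using nx[of i] True complex_norm_square[of "coeff P i"]
        by (simp add: mult.assoc del: complex_cnj_power)
      ultimately show ?thesis using True by simp
    next
      case False
      thus ?thesis using 1 sum_root_unity_powers[of i N j] by (simp add: w_def)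
    qed
  qed
  also have "\<dots> = complex_of_real (real N * (\<Sum>i<N. (cmod (coeff P i))\<^sup>2))"
    by (simp add: sum_distrib_left)
  finally show ?thesis unfolding of_real_eq_iff .
qed

section \<open>The Jackson kernel and approximation by its averages\<close>

text \<open>At \<open>u = cis t\<close> with \<open>u\<close> different from 1 its modulus is that
  of sin(m t / 2) / sin(t / 2), so the fourth power of the modulus is the unnormalised Jackson
  kernel.\<close>

definition geom_poly :: "nat \<Rightarrow> complex poly" where
  "geom_poly m = (\<Sum>i<m. monom 1 i)"

lemma poly_geom_poly: "poly (geom_poly m) u = (\<Sum>i<m. u ^ i)"
  by (simp add: geom_poly_def poly_sum poly_monom)

lemma coeff_geom_poly: "coeff (geom_poly m) i = (if i < m then 1 else 0)"
  by (auto simp: geom_poly_def coeff_sum)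

lemma degree_geom_poly: "degree (geom_poly m) \<le> m - 1"
  by (rule degree_le) (auto simp: coeff_geom_poly)

text \<open>The rising half of the triangular coefficient sequence is enough to bound the mass of
  the kernel below by a multiple of \<open>m ^ 3\<close>, once per sample point.\<close>

lemma coeff_geom_poly_square:
  assumes "i < m"
  shows "coeff ((geom_poly m)\<^sup>2) i = of_nat (Suc i)"
proof -
  have "coeff ((geom_poly m)\<^sup>2) i = (\<Sum>k\<le>i. coeff (geom_poly m) k * coeff (geom_poly m) (i - k))"
    by (simp add: power2_eq_square coeff_mult)
  also have "\<dots> = (\<Sum>k\<le>i. 1)"
    using assms by (intro sum.cong) (auto simp: coeff_geom_poly)
  finally show ?thesis by simp
qed

lemma sum_Suc_squares_ge: "real m ^ 3 / 3 \<le> (\<Sum>i<m. (real (Suc i))\<^sup>2)"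
  by (induction m) (auto simp: power2_eq_square power3_eq_cube field_simps)

text \<open>The coefficients of \<open>geom_poly m\<close> are palindromic, which turns the Jackson kernel into a
  Laurent polynomial.\<close>

lemma norm_geom_poly_pow4:
  assumes "cmod u = 1" "m \<ge> 1"
  shows "complex_of_real (cmod (poly (geom_poly m) u) ^ 4) * u ^ (2 * m - 2) = poly (geom_poly m) u ^ 4"
proof -
  let ?d = "poly (geom_poly m) u"
  have uu: "u * cnj u = 1" using assms by (intro mult_cnj_unit)
  have "cnj ?d * u ^ (m - 1) = (\<Sum>i<m. cnj u ^ i * u ^ (m - 1))"
    by (simp add: poly_geom_poly sum_distrib_right)
  also have "\<dots> = (\<Sum>i<m. u ^ (m - 1 - i))"
  proof (intro sum.cong refl)
    fix i assume "i \<in> {..<m}"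
    hence "u ^ (m - 1) = u ^ i * u ^ (m - 1 - i)" by (simp flip: power_add)
    moreover have "cnj u ^ i * u ^ i = 1"
      using uu by (simp add: mult.commute flip: power_mult_distrib)
    ultimately show "cnj u ^ i * u ^ (m - 1) = u ^ (m - 1 - i)"
      by (simp add: mult.assoc[symmetric])
  qed
  also have "\<dots> = ?d"
    using sum.nat_diff_reindex[of "\<lambda>i. u ^ i" m] by (simp add: poly_geom_poly)
  finally have d: "cnj ?d * u ^ (m - 1) = ?d" .
  have "complex_of_real (cmod ?d ^ 4) = (complex_of_real ((cmod ?d)\<^sup>2))\<^sup>2"
    by (simp flip: power_mult)
  also have "\<dots> = (?d * cnj ?d)\<^sup>2"
    by (simp only: complex_norm_square)
  finally have "complex_of_real (cmod ?d ^ 4) * u ^ (2 * m - 2) = (?d * (cnj ?d * u ^ (m - 1)))\<^sup>2"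
    by (simp add: power_mult_distrib mult_ac right_diff_distrib' flip: power_mult)
  also have "\<dots> = ?d ^ 4" unfolding d by (simp add: eval_nat_numeral)
  finally show ?thesis .
qed

text \<open>The Jackson kernel is sampled at the \<open>N\<close>-th roots of unity with
  \<open>N = 2 * m - 1\<close>, so that \<open>discrete_parseval\<close> evaluates its moments and no integral is needed.
  The factor \<open>x ^ p\<close> clears the negative powers.\<close>

lemma jackson_approximation:
  fixes F :: "complex \<Rightarrow> complex"
  assumes m: "m \<ge> 1" "2 * m - 2 \<le> p" "2 * m - 2 \<le> q" and a: "a \<ge> 0"
    and F: "\<And>x w. cmod x = 1 \<Longrightarrow> cmod w = 1 \<Longrightarrow> cmod (F x - F w) \<le> a * (cmod (x - w))\<^sup>2 + b"
  obtains R where "degree R \<le> p + q"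
    "\<And>x. cmod x = 1 \<Longrightarrow> cmod (x ^ p * F x - poly R x) \<le> 12 * a / (real m)\<^sup>2 + b"
proof -
  \<comment> \<open>The least sample count exceeding \<open>2 * m - 2\<close>, the degree bound for
    the square of \<open>D\<close>, as \<open>discrete_parseval\<close> requires.\<close>
  define N where "N = 2 * m - 1"
  define w where "w = cis (2 * pi / real N)"
  define D where "D = geom_poly m"
  \<comment> \<open>This is the total kernel mass on the grid. By Parseval it is the same for every
    evaluation point, so dividing by it keeps \<open>R\<close> a polynomial.\<close>
  define S where "S = real N * (\<Sum>i<N. (cmod (coeff (D\<^sup>2) i))\<^sup>2)"
  \<comment> \<open>\<open>R\<close> is \<open>x ^ p\<close> times the kernel average of the samples
    \<open>F (w ^ k)\<close>: \<open>norm_geom_poly_pow4\<close> at \<open>x * cnj (w ^ k)\<close>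
    turns the kernel into the fourth power of \<open>D\<close> times
    \<open>(w ^ k) ^ (2 * m - 2)\<close>, divided by \<open>x ^ (2 * m - 2)\<close>.\<close>
  define R where "R = (\<Sum>k<N. smult (F (w ^ k) * (w ^ k) ^ (2 * m - 2) / S)
      (monom 1 (p - (2 * m - 2)) * pcompose D [:0, cnj (w ^ k):] ^ 4))"
  have w1: "cmod (w ^ k) = 1" for k by (simp add: w_def norm_power)
  have cw: "cnj (w ^ k) = cnj w ^ k" for k by simp
  have N: "N > 0" using m by (simp add: N_def)
  have dD: "degree D \<le> m - 1" unfolding D_def by (rule degree_geom_poly)
  have dD2: "degree (D\<^sup>2) < N"
    using degree_power_le[of D 2] dD m by (simp add: N_def)
  have S_ge: "S \<ge> real N * (real m ^ 3 / 3)"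
  proof -
    have "real m ^ 3 / 3 \<le> (\<Sum>i<m. (real (Suc i))\<^sup>2)" by (rule sum_Suc_squares_ge)
    also have "\<dots> = (\<Sum>i<m. (cmod (coeff (D\<^sup>2) i))\<^sup>2)"
      by (intro sum.cong refl) (simp add: D_def coeff_geom_poly_square del: of_nat_Suc)
    also have "\<dots> \<le> (\<Sum>i<N. (cmod (coeff (D\<^sup>2) i))\<^sup>2)"
      using m by (intro sum_mono2) (auto simp: N_def)
    finally show ?thesis unfolding S_def by (rule mult_left_mono) simp
  qed
  have denom_pos: "real N * (real m ^ 3 / 3) > 0" using N m by simp
  hence S_pos: "S > 0" using S_ge by linarith
  show ?thesis
  proof
    \<comment> \<open>The degrees add up to at most
      \<open>p - (2 * m - 2) + 4 * (m - 1) = p + (2 * m - 2)\<close>, so the bound on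
      \<open>q\<close> finishes the count.\<close>
    have "degree (monom 1 (p - (2 * m - 2)) * pcompose D [:0, c:] ^ 4) \<le> p + q" for c :: complex
    proof -
      have "degree (pcompose D [:0, c:]) \<le> m - 1"
        using degree_pcompose_le[of D "[:0, c:]"] dD
        by (auto simp: degree_pCons_eq_if split: if_splits)
      hence "degree (pcompose D [:0, c:] ^ 4) \<le> (m - 1) * 4"
        using degree_power_le[of "pcompose D [:0, c:]" 4] by simp
      thus ?thesis
        using degree_mult_le[of "monom 1 (p - (2 * m - 2))" "pcompose D [:0, c:] ^ 4"]
          degree_monom_le[of "1 :: complex" "p - (2 * m - 2)"] m by linarith
    qed
    thus "degree R \<le> p + q"
      unfolding R_def by (intro degree_sum_le) (auto intro: order.trans[OF degree_smult_le])
  next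
    fix x :: complex
    assume x: "cmod x = 1"
    define u where "u k = x * cnj (w ^ k)" for k
    define v where "v k = cmod (poly D (u k)) ^ 4" for k
    have u1: "cmod (u k) = 1" for k using x w1 by (simp add: u_def norm_mult del: complex_cnj_power)
    have ww: "w ^ k * cnj (w ^ k) = 1" for k
      by (rule mult_cnj_unit[OF w1])
    have uw: "u k * w ^ k = x" for k
    proof -
      have "u k * w ^ k = x * (w ^ k * cnj (w ^ k))" unfolding u_def by (simp only: mult_ac)
      thus ?thesis unfolding ww by simp
    qed
    \<comment> \<open>The points \<open>u k\<close> run through the grid backwards; conjugating the
      coefficients of \<open>P\<close> moves them to the forward grid started at
      \<open>cnj x\<close>.\<close>
    have parseval: "(\<Sum>k<N. (cmod (poly P (u k)))\<^sup>2) = real N * (\<Sum>i<N. (cmod (coeff P i))\<^sup>2)"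
      if P: "degree P < N" for P
    proof -
      have "(\<Sum>k<N. (cmod (poly P (u k)))\<^sup>2) = (\<Sum>k<N. (cmod (poly (map_poly cnj P) (cnj x * w ^ k)))\<^sup>2)"
      proof (intro sum.cong refl)
        fix k
        have "poly (map_poly cnj P) (cnj x * w ^ k) = cnj (poly P (u k))"
          unfolding poly_cnj by (simp add: u_def)
        thus "(cmod (poly P (u k)))\<^sup>2 = (cmod (poly (map_poly cnj P) (cnj x * w ^ k)))\<^sup>2" by simp
      qed
      also have "\<dots> = real N * (\<Sum>i<N. (cmod (coeff (map_poly cnj P) i))\<^sup>2)"
        unfolding w_def using P x by (intro discrete_parseval) (auto simp: degree_map_poly)
      finally show ?thesis by (simp add: coeff_map_poly)
    qed
    have v_sum: "(\<Sum>k<N. v k) = S"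
      using parseval[OF dD2] by (simp add: v_def S_def norm_power flip: power_mult)
    have R: "poly R x = x ^ p * (\<Sum>k<N. of_real (v k / S) * F (w ^ k))"
    proof -
      have "poly R x = (\<Sum>k<N. F (w ^ k) * (w ^ k) ^ (2 * m - 2) / S * (x ^ (p - (2 * m - 2)) * poly D (u k) ^ 4))"
        unfolding R_def
        by (simp add: poly_sum poly_monom poly_pcompose u_def mult_ac)
      also have "\<dots> = (\<Sum>k<N. x ^ p * (of_real (v k / S) * F (w ^ k)))"
      proof (intro sum.cong refl)
        fix k
        have D4: "poly D (u k) ^ 4 = of_real (v k) * u k ^ (2 * m - 2)"
          unfolding D_def v_def using norm_geom_poly_pow4[OF u1 m(1)] by simp
        have "(w ^ k) ^ (2 * m - 2) * u k ^ (2 * m - 2) = (u k * w ^ k) ^ (2 * m - 2)"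
          by (simp only: power_mult_distrib mult.commute)
        hence "(w ^ k) ^ (2 * m - 2) * u k ^ (2 * m - 2) * x ^ (p - (2 * m - 2)) = x ^ p"
          by (simp only: uw power_add[symmetric] le_add_diff_inverse[OF m(2)])
        thus "F (w ^ k) * (w ^ k) ^ (2 * m - 2) / S * (x ^ (p - (2 * m - 2)) * poly D (u k) ^ 4)
            = x ^ p * (of_real (v k / S) * F (w ^ k))"
          by (simp only: D4 of_real_divide) (simp only: divide_inverse mult_ac)
      qed
      finally show ?thesis by (simp add: sum_distrib_left)
    qed
    have one: "(\<Sum>k<N. v k / S) = 1"
      using v_sum S_pos by (simp flip: sum_divide_distrib)
    have "x ^ p * F x - poly R x = x ^ p * (\<Sum>k<N. of_real (v k / S) * (F x - F (w ^ k)))"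
    proof -
      have "F x = (\<Sum>k<N. of_real (v k / S) * F x)"
        by (subst sum_distrib_right[symmetric], subst of_real_sum[symmetric], subst one) simp
      thus ?thesis unfolding R by (simp only: right_diff_distrib sum_subtractf)
    qed
    hence "cmod (x ^ p * F x - poly R x) = cmod (\<Sum>k<N. of_real (v k / S) * (F x - F (w ^ k)))"
      using x by (simp add: norm_mult norm_power)
    also have "\<dots> \<le> (\<Sum>k<N. v k / S * (a * (cmod (x - w ^ k))\<^sup>2 + b))"
    proof (rule sum_norm_le)
      fix k
      have "v k / S \<ge> 0" using S_pos by (simp add: v_def)
      thus "cmod (of_real (v k / S) * (F x - F (w ^ k))) \<le> v k / S * (a * (cmod (x - w ^ k))\<^sup>2 + b)"
        using F[OF x w1[of k]] by (simp only: norm_mult norm_of_real abs_of_nonneg mult_left_mono)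
    qed
    also have "\<dots> = a / S * (\<Sum>k<N. v k * (cmod (x - w ^ k))\<^sup>2) + (\<Sum>k<N. v k / S) * b"
      unfolding sum_distrib_left sum_distrib_right sum.distrib[symmetric]
      by (intro sum.cong refl) (simp add: distrib_left)
    also have "\<dots> \<le> a / S * (4 * real N * real m) + b"
    proof -
      \<comment> \<open>The distance is \<open>cmod (u k - 1)\<close>, and multiplication by
        \<open>u k - 1\<close> telescopes the geometric sum. So the squared distance absorbs two of
        the four factors of the kernel at the cost of a constant 4, and Parseval for
        \<open>D\<close> evaluates the rest.\<close>
      have "(\<Sum>k<N. v k * (cmod (x - w ^ k))\<^sup>2) \<le> (\<Sum>k<N. 4 * (cmod (poly D (u k)))\<^sup>2)"
      proof (rule sum_mono)
        fix k
        have "x - w ^ k = (u k - 1) * w ^ k" using uw[of k] by (simp add: algebra_simps)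
        hence "cmod (x - w ^ k) = cmod (u k - 1)" using w1[of k] by (simp add: norm_mult)
        moreover have "(u k - 1) * poly D (u k) = u k ^ m - 1"
          unfolding D_def poly_geom_poly by (simp add: power_diff_1_eq)
        hence "cmod (u k - 1) * cmod (poly D (u k)) = cmod (u k ^ m - 1)" by (simp flip: norm_mult)
        moreover have "cmod (u k ^ m - 1) \<le> 2"
          using norm_triangle_ineq4[of "u k ^ m" 1] u1[of k] by (simp add: norm_power)
        ultimately have "(cmod (x - w ^ k) * cmod (poly D (u k)))\<^sup>2 \<le> 2\<^sup>2"
          by (intro power_mono) auto
        hence "(cmod (x - w ^ k) * cmod (poly D (u k)))\<^sup>2 * (cmod (poly D (u k)))\<^sup>2
            \<le> 4 * (cmod (poly D (u k)))\<^sup>2"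
          by (intro mult_right_mono) auto
        thus "v k * (cmod (x - w ^ k))\<^sup>2 \<le> 4 * (cmod (poly D (u k)))\<^sup>2"
          by (simp add: v_def power_mult_distrib eval_nat_numeral mult_ac)
      qed
      also have "\<dots> = 4 * (real N * (\<Sum>i<N. (cmod (coeff D i))\<^sup>2))"
        using parseval[of D] dD m by (simp add: N_def flip: sum_distrib_left)
      also have "(\<Sum>i<N. (cmod (coeff D i))\<^sup>2) = (\<Sum>i<m. 1)"
        using m by (intro sum.mono_neutral_cong_right) (auto simp: D_def coeff_geom_poly N_def)
      finally have "(\<Sum>k<N. v k * (cmod (x - w ^ k))\<^sup>2) \<le> 4 * real N * real m" by simp
      moreover have "a / S \<ge> 0" using a S_pos by simp
      ultimately show ?thesis unfolding one mult_1 by (intro add_right_mono mult_left_mono)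
    qed
    \<comment> \<open>The second moment \<open>4 * N * m\<close> over the mass bound
      \<open>N * m ^ 3 / 3\<close> yields the constant 12.\<close>
    also have "a / S * (4 * real N * real m) \<le> a / (real N * (real m ^ 3 / 3)) * (4 * real N * real m)"
      by (intro mult_right_mono divide_left_mono mult_pos_pos S_ge a S_pos denom_pos) simp
    also have "\<dots> = 12 * a / (real m)\<^sup>2"
      using N m by (simp add: field_simps power2_eq_square power3_eq_cube)
    finally show "cmod (x ^ p * F x - poly R x) \<le> 12 * a / (real m)\<^sup>2 + b" by simp
  qed
qed

section \<open>From the modulus of continuity to a rate of approximation\<close>

text \<open>This makes the real supremum in \<open>modulus_of_continuity\<close> a genuine upper
  bound, through \<open>cSup_upper\<close>.\<close>

lemma bounded_modulus_set:
  assumes "continuous_on unit_circle F"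
  shows "bdd_above {cmod (F z1 - F z2) | z1 z2. z1 \<in> unit_circle \<and> z2 \<in> unit_circle \<and> cmod (z1 - z2) < \<delta>}"
proof -
  have "bounded (F ` unit_circle)"
    using assms by (intro compact_imp_bounded compact_continuous_image) auto
  then obtain M where M: "\<And>x. x \<in> unit_circle \<Longrightarrow> cmod (F x) \<le> M"
    unfolding bounded_iff by blast
  show ?thesis
  proof (rule bdd_aboveI[of _ "M + M"], clarify)
    fix z1 z2 :: complex assume "z1 \<in> unit_circle" "z2 \<in> unit_circle"
    thus "cmod (F z1 - F z2) \<le> M + M"
      using norm_triangle_ineq4[of "F z1" "F z2"] M[of z1] M[of z2] by linarith
  qed
qed

text \<open>The little-o hypothesis handles close points. For points at distance bounded below,
  \<open>F\<close> is bounded and the quadratic term, which the Jackson kernel tolerates, pays for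
  the whole difference.\<close>

lemma small_modulus_bound:
  assumes cont: "continuous_on unit_circle F"
    and o: "modulus_of_continuity F \<in> o[at_right 0](\<lambda>\<delta>. \<delta> powr (1 / 2))"
    and e: "e > 0"
  obtains K where "K \<ge> 0" "\<And>x w. cmod x = 1 \<Longrightarrow> cmod w = 1 \<Longrightarrow>
    cmod (F x - F w) \<le> e * sqrt (cmod (x - w)) + K * (cmod (x - w))\<^sup>2"
proof -
  have "bounded (F ` unit_circle)"
    using cont by (intro compact_imp_bounded compact_continuous_image) auto
  then obtain M where M: "\<And>x. x \<in> unit_circle \<Longrightarrow> cmod (F x) \<le> M" and M0: "M > 0"
    unfolding bounded_pos by blast
  have "\<forall>\<^sub>F d in at_right 0. norm (modulus_of_continuity F d) \<le> e / 2 * norm (d powr (1 / 2))"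
    using o e by (intro landau_o.smallD) auto
  then obtain d where d: "d > 0"
    "\<And>t. 0 < t \<Longrightarrow> t < d \<Longrightarrow> norm (modulus_of_continuity F t) \<le> e / 2 * norm (t powr (1 / 2))"
    unfolding eventually_at_right[OF zero_less_one] by auto
  show ?thesis
  proof
    \<comment> \<open>At distance \<open>d / 2\<close> the quadratic term with this constant equals
      \<open>2 * M\<close>, the trivial bound on differences of \<open>F\<close>.\<close>
    show "8 * M / d\<^sup>2 \<ge> 0" using M0 by simp
  next
    fix x w :: complex assume x: "cmod x = 1" and w: "cmod w = 1"
    define s where "s = cmod (x - w)"
    consider "s = 0" | "0 < s" "2 * s < d" | "2 * s \<ge> d"
      using norm_ge_zero[of "x - w"] unfolding s_def by linarith
    hence "cmod (F x - F w) \<le> e * sqrt s + 8 * M / d\<^sup>2 * s\<^sup>2"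
    proof cases
      case 1
      thus ?thesis by (simp add: s_def)
    next
      case 2
      \<comment> \<open>The modulus takes strictly smaller distances, hence the argument
        \<open>2 * s\<close>. The factor lost, at most 2 after the square root, is paid by the
        \<open>e / 2\<close> above.\<close>
      have "cmod (F x - F w) \<le> modulus_of_continuity F (2 * s)"
        unfolding modulus_of_continuity_def
      proof (rule cSup_upper[OF _ bounded_modulus_set[OF cont]])
        show "cmod (F x - F w) \<in> {cmod (F z1 - F z2) | z1 z2.
            z1 \<in> unit_circle \<and> z2 \<in> unit_circle \<and> cmod (z1 - z2) < 2 * s}"
          using 2 x w unfolding s_def mem_Collect_eq by (intro exI[of _ x] exI[of _ w]) auto
      qed
      also have "\<dots> \<le> e / 2 * sqrt (2 * s)"
        using d(2)[of "2 * s"] 2 by (simp add: powr_half_sqrt)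
      also have "sqrt (2 * s) \<le> sqrt (2\<^sup>2 * s)" using 2 by (intro real_sqrt_le_mono) auto
      also have "\<dots> = 2 * sqrt s" by (simp only: real_sqrt_mult real_sqrt_power) simp
      finally have "cmod (F x - F w) \<le> e * sqrt s" using e by simp
      moreover have "8 * M / d\<^sup>2 * s\<^sup>2 \<ge> 0" using M0 by simp
      ultimately show ?thesis by linarith
    next
      case 3
      have "cmod (F x - F w) \<le> 2 * M"
        using norm_triangle_ineq4[of "F x" "F w"] M[of x] M[of w] x w by auto
      also have "\<dots> = 8 * M / d\<^sup>2 * (d / 2)\<^sup>2" using d by (simp add: field_simps power2_eq_square)
      also have "\<dots> \<le> 8 * M / d\<^sup>2 * s\<^sup>2"
        using 3 d M0 by (intro mult_left_mono power_mono) auto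
      finally have "cmod (F x - F w) \<le> 8 * M / d\<^sup>2 * s\<^sup>2" .
      moreover have "e * sqrt s \<ge> 0" using e by (simp add: s_def)
      ultimately show ?thesis by linarith
    qed
    thus "cmod (F x - F w) \<le> e * sqrt (cmod (x - w)) + 8 * M / d\<^sup>2 * (cmod (x - w))\<^sup>2"
      by (simp add: s_def)
  qed
qed

text \<open>The square-root term is replaced by a quadratic one plus a constant, weighted according
  to \<open>m\<close>, so that \<open>jackson_approximation\<close> applies. \<open>K\<close>
  depends on \<open>F\<close> and \<open>e\<close> but not on \<open>m\<close>, so its contribution
  becomes negligible as \<open>m\<close> grows.\<close>

lemma small_modulus_approximation:
  assumes cont: "continuous_on unit_circle F"
    and o: "modulus_of_continuity F \<in> o[at_right 0](\<lambda>\<delta>. \<delta> powr (1 / 2))"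
    and e: "e > 0"
  obtains K where "K \<ge> 0" "\<And>m p q. m \<ge> 1 \<Longrightarrow> 2 * m - 2 \<le> p \<Longrightarrow> 2 * m - 2 \<le> q \<Longrightarrow>
    \<exists>R. degree R \<le> p + q \<and>
      (\<forall>x. cmod x = 1 \<longrightarrow> cmod (x ^ p * F x - poly R x) \<le> (13 * e + 12 * K / real m) / sqrt (real m))"
proof -
  obtain K where K: "K \<ge> 0" "\<And>x w. cmod x = 1 \<Longrightarrow> cmod w = 1 \<Longrightarrow>
      cmod (F x - F w) \<le> e * sqrt (cmod (x - w)) + K * (cmod (x - w))\<^sup>2"
    using small_modulus_bound[OF assms] by blast
  show ?thesis
  proof
    show "K \<ge> 0" by fact
  next
    fix m p q :: nat
    assume m: "m \<ge> 1" "2 * m - 2 \<le> p" "2 * m - 2 \<le> q"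
    \<comment> \<open>This choice balances the two costs: \<open>12 * e * t ^ 3 / m\<^sup>2\<close>
      equals \<open>12 * e / t\<close>, which joins the constant \<open>e / t\<close> to make
      \<open>13 * e / t\<close>.\<close>
    define t where "t = sqrt (real m)"
    have t: "t \<ge> 1" "t\<^sup>2 = real m" using m by (auto simp: t_def)
    have "cmod (F x - F w) \<le> (e * t ^ 3 + K) * (cmod (x - w))\<^sup>2 + e / t"
      if x: "cmod x = 1" and w: "cmod w = 1" for x w
    proof -
      define s where "s = sqrt (cmod (x - w))"
      have s: "s \<ge> 0" "s\<^sup>2 = cmod (x - w)" by (auto simp: s_def)
      \<comment> \<open>Dividing by \<open>t\<close> bounds \<open>s\<close>, the root of the
        distance, by \<open>t ^ 3 * s ^ 4 + 1 / t\<close>, where \<open>s ^ 4\<close> is the squared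
        distance.\<close>
      have "t * s \<le> (t * s) ^ 4 + 1"
      proof (cases "t * s \<le> 1")
        case True thus ?thesis by (smt (verit) zero_le_even_power even_numeral)
      next
        case False thus ?thesis using self_le_power[of "t * s" 4] by simp
      qed
      hence "s \<le> t ^ 3 * s ^ 4 + 1 / t"
        using t(1) by (simp add: field_simps power_mult_distrib eval_nat_numeral)
      hence "e * s \<le> e * (t ^ 3 * s ^ 4 + 1 / t)" using e by (intro mult_left_mono) auto
      moreover have "s ^ 4 = (cmod (x - w))\<^sup>2" using s(2) by (simp flip: power_mult s(2))
      ultimately show ?thesis
        using K(2)[OF x w] by (simp add: algebra_simps flip: s_def)
    qed
    then obtain R where R: "degree R \<le> p + q"
      "\<And>x. cmod x = 1 \<Longrightarrow> cmod (x ^ p * F x - poly R x) \<le> 12 * (e * t ^ 3 + K) / (real m)\<^sup>2 + e / t"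
      using jackson_approximation[OF m, of "e * t ^ 3 + K" F "e / t"] K(1) e t(1) by auto
    have "12 * (e * t ^ 3 + K) / (real m)\<^sup>2 + e / t = 13 * e / t + 12 * K / real m / t\<^sup>2"
      using t(1) unfolding t(2)[symmetric] by (simp add: field_simps eval_nat_numeral)
    also have "\<dots> \<le> 13 * e / t + 12 * K / real m / t"
      using t(1) K(1) by (intro add_left_mono divide_left_mono) (auto simp: power2_eq_square)
    also have "\<dots> = (13 * e + 12 * K / real m) / sqrt (real m)"
      by (simp add: t_def add_divide_distrib)
    finally show "\<exists>R. degree R \<le> p + q \<and>
      (\<forall>x. cmod x = 1 \<longrightarrow> cmod (x ^ p * F x - poly R x) \<le> (13 * e + 12 * K / real m) / sqrt (real m))"
      using R by (intro exI[of _ R]) force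
  qed
qed

section \<open>Laurent polynomials as shifted polynomials\<close>

text \<open>Shifting exponents by \<open>p\<close> reduces existence and uniqueness to ordinary
  polynomials. The equality is one of functions on the whole plane, including 0, as the description
  operator in \<open>laurent_interpolant\<close> demands.\<close>

lemma laurent_space_iff_poly:
  "P \<in> laurent_space p q \<longleftrightarrow>
    (\<exists>Q. degree Q \<le> p + q \<and> P = (\<lambda>x. \<Sum>i\<le>p + q. coeff Q i * x powi (int i - int p)))"
proof -
  have reindex: "(\<Sum>k = - int p..int q. c k * x powi k) = (\<Sum>i\<le>p + q. c (int i - int p) * x powi (int i - int p))"
    for c and x :: complex
    by (rule sum.reindex_bij_witness[of _ "\<lambda>i. int i - int p" "\<lambda>k. nat (k + int p)"]) auto
  show ?thesis
  proof
    assume "P \<in> laurent_space p q"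
    then obtain c where c: "P = (\<lambda>x. \<Sum>k = - int p..int q. c k * x powi k)"
      by (auto simp: laurent_space_def)
    define Q where "Q = (\<Sum>i\<le>p + q. monom (c (int i - int p)) i)"
    have Q: "coeff Q i = (if i \<le> p + q then c (int i - int p) else 0)" for i
      by (auto simp: Q_def coeff_sum)
    have "degree Q \<le> p + q" by (rule degree_le) (auto simp: Q)
    moreover have "P = (\<lambda>x. \<Sum>i\<le>p + q. coeff Q i * x powi (int i - int p))"
      unfolding c reindex by (simp add: Q)
    ultimately show "\<exists>Q. degree Q \<le> p + q \<and> P = (\<lambda>x. \<Sum>i\<le>p + q. coeff Q i * x powi (int i - int p))"
      by blast
  next
    assume "\<exists>Q. degree Q \<le> p + q \<and> P = (\<lambda>x. \<Sum>i\<le>p + q. coeff Q i * x powi (int i - int p))"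
    then obtain Q where "P = (\<lambda>x. \<Sum>i\<le>p + q. coeff Q i * x powi (int i - int p))" by blast
    thus "P \<in> laurent_space p q"
      unfolding laurent_space_def mem_Collect_eq
      by (intro exI[of _ "\<lambda>k. coeff Q (nat (k + int p))"]) (simp add: reindex)
  qed
qed

lemma laurent_sum_eq_poly:
  fixes x :: complex
  assumes "degree Q \<le> d" "x \<noteq> 0"
  shows "x ^ p * (\<Sum>i\<le>d. coeff Q i * x powi (int i - int p)) = poly Q x"
proof -
  have "x ^ p * (\<Sum>i\<le>d. coeff Q i * x powi (int i - int p)) = (\<Sum>i\<le>d. coeff Q i * x ^ i)"
    using assms by (simp add: sum_distrib_left power_int_diff)
  also have "\<dots> = poly Q x"
    unfolding poly_altdef using assms by (intro sum.mono_neutral_right) (auto simp: coeff_eq_0 not_le)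
  finally show ?thesis .
qed

section \<open>Lagrange interpolation and its norm on the circle\<close>

lemma poly_eq_of_agree:
  fixes P Q :: "complex poly"
  assumes "inj_on z {1..n}" "degree P < n" "degree Q < n"
    and "\<And>j. j \<in> {1..n} \<Longrightarrow> poly P (z j) = poly Q (z j)"
  shows "P = Q"
  by (rule poly_eqI_degree[of "z ` {1..n}"]) (use assms in \<open>auto simp: card_image\<close>)

lemma nodal_poly_div:
  assumes "j \<in> {1..n}"
  shows "nodal_poly n z div [:- z j, 1:] = (\<Prod>i\<in>{1..n} - {j}. [:- z i, 1:])"
proof -
  have "nodal_poly n z = [:- z j, 1:] * (\<Prod>i\<in>{1..n} - {j}. [:- z i, 1:])"
    unfolding nodal_poly_def using assms by (intro prod.remove) auto
  moreover have "[:- z j, 1:] \<noteq> 0" by simp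
  ultimately show ?thesis by (metis nonzero_mult_div_cancel_left)
qed

text \<open>In the product rule, the term that keeps the factor \<open>[:- z j, 1:]\<close> vanishes
  at \<open>z j\<close>.\<close>

lemma pderiv_nodal_poly:
  assumes "j \<in> {1..n}"
  shows "poly (pderiv (nodal_poly n z)) (z j) = poly (nodal_poly n z div [:- z j, 1:]) (z j)"
proof -
  have "nodal_poly n z = [:- z j, 1:] * (nodal_poly n z div [:- z j, 1:])"
    unfolding nodal_poly_div[OF assms] unfolding nodal_poly_def
    using assms by (intro prod.remove) auto
  hence "pderiv (nodal_poly n z) = pderiv ([:- z j, 1:] * (nodal_poly n z div [:- z j, 1:]))" by simp
  thus ?thesis by (simp only: pderiv_mult poly_add poly_mult) (simp add: pderiv_pCons)
qed

text \<open>Writing the basis through the nodal polynomial and its derivative lets condition (i)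
  control the denominators and condition (ii) the numerators.\<close>

definition lagrange_poly :: "nat \<Rightarrow> (nat \<Rightarrow> complex) \<Rightarrow> (nat \<Rightarrow> complex) \<Rightarrow> complex poly" where
  "lagrange_poly n z y = (\<Sum>j = 1..n. smult (y j / poly (pderiv (nodal_poly n z)) (z j))
     (nodal_poly n z div [:- z j, 1:]))"

lemma degree_lagrange_poly:
  assumes "n \<ge> 1"
  shows "degree (lagrange_poly n z y) < n"
proof -
  have "degree (nodal_poly n z div [:- z j, 1:]) \<le> n - 1" if "j \<in> {1..n}" for j
  proof -
    have "degree (\<Prod>i\<in>{1..n} - {j}. [:- z i, 1:]) \<le> (\<Sum>i\<in>{1..n} - {j}. degree [:- z i, 1:])"
      by (intro degree_prod_sum_le[unfolded comp_def]) auto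
    also have "\<dots> = n - 1" using that by simp
    finally show ?thesis by (simp only: nodal_poly_div[OF that])
  qed
  hence "degree (lagrange_poly n z y) \<le> n - 1"
    unfolding lagrange_poly_def
    by (intro degree_sum_le) (auto intro: order.trans[OF degree_smult_le])
  thus ?thesis using assms by simp
qed

lemma poly_lagrange_poly:
  assumes "inj_on z {1..n}" "k \<in> {1..n}"
  shows "poly (lagrange_poly n z y) (z k) = y k"
proof -
  have *: "poly (nodal_poly n z div [:- z j, 1:]) (z k) = (\<Prod>i\<in>{1..n} - {j}. z k - z i)"
    if "j \<in> {1..n}" for j
    unfolding nodal_poly_div[OF that] by (simp add: poly_prod)
  have "z k - z i \<noteq> 0" if "i \<in> {1..n} - {k}" for i
    using that assms by (metis DiffE inj_onD insertCI right_minus_eq)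
  hence "(\<Prod>i\<in>{1..n} - {k}. z k - z i) \<noteq> 0" by (simp add: prod_zero_iff)
  hence "y k / poly (pderiv (nodal_poly n z)) (z k) * poly (nodal_poly n z div [:- z k, 1:]) (z k) = y k"
    using *[OF assms(2)] by (simp add: pderiv_nodal_poly[OF assms(2)])
  moreover have "poly (nodal_poly n z div [:- z j, 1:]) (z k) = 0" if "j \<in> {1..n} - {k}" for j
    unfolding *[OF DiffD1[OF that]] using that assms(2) by (intro prod_zero bexI[of _ k]) auto
  ultimately show ?thesis
    unfolding lagrange_poly_def poly_sum poly_smult using assms(2)
    by (subst sum.remove[of _ k]) auto
qed

text \<open>Condition (i), taken at the nodes, bounds each denominator below by
  \<open>B * n\<close>. Condition (ii) controls only the sum of squares of the numerators, and
  passing from it to the plain sum costs \<open>sqrt n\<close>.\<close>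

lemma lagrange_poly_bound:
  assumes n: "n \<ge> 1" and B: "B > 0" and x: "x \<in> unit_circle"
    and z: "\<And>j. j \<in> {1..n} \<Longrightarrow> z j \<in> unit_circle"
    and i: "\<forall>x\<in>unit_circle. B \<le> cmod (poly (pderiv (nodal_poly n z)) x) / real n"
    and ii: "\<forall>x\<in>unit_circle.
      (\<Sum>j = 1..n. (cmod (poly (nodal_poly n z div [:- z j, 1:]) x))\<^sup>2) / (real n)\<^sup>2 \<le> L"
    and y: "\<And>j. j \<in> {1..n} \<Longrightarrow> cmod (y j) \<le> e"
  shows "cmod (poly (lagrange_poly n z y) x) \<le> e * sqrt (real n) * (sqrt L / B)"
proof -
  let ?h = "\<lambda>j. cmod (poly (nodal_poly n z div [:- z j, 1:]) x)"
  have e: "e \<ge> 0" using y[of 1] n by (meson atLeastAtMost_iff le_refl norm_ge_zero order.trans)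
  have "cmod (poly (lagrange_poly n z y) x) \<le> (\<Sum>j = 1..n. e / (B * real n) * ?h j)"
    unfolding lagrange_poly_def poly_sum poly_smult
  proof (rule sum_norm_le)
    fix j assume j: "j \<in> {1..n}"
    have "B * real n \<le> cmod (poly (pderiv (nodal_poly n z)) (z j))"
      using i z[OF j] n by (auto simp: field_simps)
    hence "cmod (y j) / cmod (poly (pderiv (nodal_poly n z)) (z j)) \<le> e / (B * real n)"
      using y[OF j] e B n by (intro frac_le) auto
    thus "cmod (y j / poly (pderiv (nodal_poly n z)) (z j) * poly (nodal_poly n z div [:- z j, 1:]) x)
        \<le> e / (B * real n) * ?h j"
      by (simp add: norm_mult norm_divide mult_right_mono del: times_divide_eq_left)
  qed
  \<comment> \<open>The factor 1 is the second vector for the Cauchy-Schwarz inequality.\<close>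
  also have "\<dots> = e / (B * real n) * (\<Sum>j = 1..n. 1 * ?h j)" by (simp add: sum_distrib_left)
  also have "\<dots> \<le> e / (B * real n) * (sqrt (real n) * sqrt L * real n)"
  proof (rule mult_left_mono)
    have "(\<Sum>j = 1..n. 1 * ?h j) \<le> sqrt (real n * (\<Sum>j = 1..n. (?h j)\<^sup>2))"
      using Cauchy_Schwarz_ineq_sum[of "\<lambda>_. 1" ?h "{1..n}"] by (intro real_le_rsqrt) simp
    also have "\<dots> \<le> sqrt (real n * (L * (real n)\<^sup>2))"
      using bspec[OF ii x] n by (intro real_sqrt_le_mono mult_left_mono) (auto simp: field_simps)
    finally show "(\<Sum>j = 1..n. 1 * ?h j) \<le> sqrt (real n) * sqrt L * real n"
      by (simp add: real_sqrt_mult)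
  qed (use e B in simp)
  also have "\<dots> = e * sqrt (real n) * (sqrt L / B)"
    using n B by (simp add: field_simps)
  finally show ?thesis .
qed

section \<open>The Laurent interpolant and its error\<close>

text \<open>Multiplication by \<open>x ^ p\<close> turns the Laurent problem for \<open>F\<close>
  into the polynomial problem for \<open>x ^ p * F x\<close>. The proof also supplies the existence
  and uniqueness that give the definite description its meaning.\<close>

lemma laurent_interpolant_eq_lagrange:
  assumes n: "n \<ge> 1" "p + q = n - 1"
    and z: "\<And>j. j \<in> {1..n} \<Longrightarrow> z j \<in> unit_circle" and inj: "inj_on z {1..n}"
    and x: "x \<in> unit_circle"
  shows "x ^ p * laurent_interpolant p q n z F x = poly (lagrange_poly n z (\<lambda>j. z j ^ p * F (z j))) x"
proof -
  define Q where "Q = lagrange_poly n z (\<lambda>j. z j ^ p * F (z j))"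
  define G where "G R = (\<lambda>x. \<Sum>i\<le>p + q. coeff R i * x powi (int i - int p))" for R :: "complex poly"
  have G: "x ^ p * G R x = poly R x" if "degree R \<le> p + q" "x \<in> unit_circle" for R x
    unfolding G_def using that by (intro laurent_sum_eq_poly) auto
  have Q: "degree Q \<le> p + q" using degree_lagrange_poly[OF n(1), of z "\<lambda>j. z j ^ p * F (z j)"] n by (simp add: Q_def)
  have "laurent_interpolant p q n z F = G Q"
    unfolding laurent_interpolant_def
  proof (rule the_equality)
    have "G Q (z j) = F (z j)" if j: "j \<in> {1..n}" for j
    proof -
      have "z j ^ p * G Q (z j) = z j ^ p * F (z j)"
        using G[OF Q z[OF j]] poly_lagrange_poly[OF inj j] by (simp add: Q_def)
      thus ?thesis using z[OF j] by auto
    qed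
    thus "G Q \<in> laurent_space p q \<and> (\<forall>j\<in>{1..n}. G Q (z j) = F (z j))"
      using Q unfolding laurent_space_iff_poly G_def by blast
  next
    fix P assume P: "P \<in> laurent_space p q \<and> (\<forall>j\<in>{1..n}. P (z j) = F (z j))"
    then obtain R where R: "degree R \<le> p + q" "P = G R"
      unfolding laurent_space_iff_poly G_def by blast
    have "R = Q"
    proof (rule poly_eq_of_agree[OF inj])
      show "degree R < n" "degree Q < n" using R Q n by auto
      show "poly R (z j) = poly Q (z j)" if "j \<in> {1..n}" for j
        using G[OF R(1) z[OF that]] P R(2) that poly_lagrange_poly[OF inj that] by (simp add: Q_def)
    qed
    thus "P = G Q" using R by simp
  qed
  thus ?thesis using G[OF Q x] by (simp add: Q_def)
qed

text \<open>This is a Lebesgue-type inequality: \<open>R\<close> is its own interpolant, so after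
  multiplication by \<open>x ^ p\<close> the error is the interpolant of the residual
  \<open>x ^ p * F x - poly R x\<close> minus the residual itself.\<close>

lemma laurent_interpolant_error:
  assumes n: "n \<ge> 1" "p + q = n - 1" and B: "B > 0" and x: "x \<in> unit_circle"
    and z: "\<And>j. j \<in> {1..n} \<Longrightarrow> z j \<in> unit_circle" and inj: "inj_on z {1..n}"
    and i: "\<forall>x\<in>unit_circle. B \<le> cmod (poly (pderiv (nodal_poly n z)) x) / real n"
    and ii: "\<forall>x\<in>unit_circle.
      (\<Sum>j = 1..n. (cmod (poly (nodal_poly n z div [:- z j, 1:]) x))\<^sup>2) / (real n)\<^sup>2 \<le> L"
    and R: "degree R \<le> p + q" "\<And>x. cmod x = 1 \<Longrightarrow> cmod (x ^ p * F x - poly R x) \<le> e"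
  shows "cmod (laurent_interpolant p q n z F x - F x) \<le> e * sqrt (real n) * (1 + sqrt L / B)"
proof -
  have R': "R = lagrange_poly n z (\<lambda>j. poly R (z j))"
    using R n degree_lagrange_poly[of n z] poly_lagrange_poly[OF inj]
    by (intro poly_eq_of_agree[OF inj]) auto
  have diff: "lagrange_poly n z (\<lambda>j. z j ^ p * F (z j)) - lagrange_poly n z (\<lambda>j. poly R (z j))
      = lagrange_poly n z (\<lambda>j. z j ^ p * F (z j) - poly R (z j))"
    by (simp add: lagrange_poly_def diff_divide_distrib smult_diff_left flip: sum_subtractf)
  have "cmod (laurent_interpolant p q n z F x - F x)
      = cmod (x ^ p * (laurent_interpolant p q n z F x - F x))"
    using x by (simp add: norm_mult norm_power)
  also have "x ^ p * (laurent_interpolant p q n z F x - F x)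
      = (poly (lagrange_poly n z (\<lambda>j. z j ^ p * F (z j))) x - poly R x) - (x ^ p * F x - poly R x)"
    using laurent_interpolant_eq_lagrange[OF n z inj x, where F = F] by (simp add: right_diff_distrib)
  also have "cmod \<dots> \<le> cmod (poly (lagrange_poly n z (\<lambda>j. z j ^ p * F (z j))) x - poly R x)
      + cmod (x ^ p * F x - poly R x)"
    by (rule norm_triangle_ineq4)
  also have "poly (lagrange_poly n z (\<lambda>j. z j ^ p * F (z j))) x - poly R x
      = poly (lagrange_poly n z (\<lambda>j. z j ^ p * F (z j) - poly R (z j))) x"
    by (subst R') (simp flip: diff)
  also have "cmod \<dots> \<le> e * sqrt (real n) * (sqrt L / B)"
    using z by (intro lagrange_poly_bound[OF n(1) B x z i ii] R) auto
  also have "cmod (x ^ p * F x - poly R x) \<le> e * 1" using R(2)[of x] x by simp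
  \<comment> \<open>The residual's own term is weakened by \<open>sqrt n\<close> to share a factor
    with the interpolation term; the bound at the point 1 shows \<open>e\<close>
    nonnegative.\<close>
  also have "e * 1 \<le> e * sqrt (real n)"
    using n norm_ge_zero order.trans[OF _ R(2)[of 1]] by (intro mult_left_mono) auto
  finally show ?thesis by (simp add: algebra_simps)
qed

section \<open>Growth of the degrees and uniform convergence\<close>

text \<open>With \<open>d\<close> half the distance from \<open>r\<close> to the nearer endpoint of
  the unit interval, the ratio eventually stays between \<open>d\<close> and \<open>1 - d\<close>,
  which bounds \<open>p n\<close> and the complementary \<open>q n\<close> below.\<close>

lemma eventually_degree_linear:
  fixes p q :: "nat \<Rightarrow> nat"
  assumes pq_sum: "\<And>n. n \<ge> 1 \<Longrightarrow> p n + q n = n - 1"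
    and p_lim: "(\<lambda>n. real (p n) / (real n - 1)) \<longlonglongrightarrow> r" and r: "0 < r" "r < 1"
  obtains c where "c > 0" "\<forall>\<^sub>F n in sequentially. c * real n \<le> real (min (p n) (q n))"
proof -
  define d where "d = min r (1 - r) / 2"
  have d: "0 < d" "d < r" "d < 1 - r" using r by (auto simp: d_def)
  show ?thesis
  proof
    show "d / 2 > 0" using d by simp
    have "\<forall>\<^sub>F n in sequentially. d < real (p n) / (real n - 1)"
      by (rule order_tendstoD(1)[OF p_lim]) fact
    moreover have "\<forall>\<^sub>F n in sequentially. real (p n) / (real n - 1) < 1 - d"
      using d by (intro order_tendstoD(2)[OF p_lim]) auto
    ultimately show "\<forall>\<^sub>F n in sequentially. d / 2 * real n \<le> real (min (p n) (q n))"
      using eventually_ge_at_top[of 2]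
    proof eventually_elim
      case (elim n)
      have "real n = real (p n) + real (q n) + 1" using pq_sum[of n] elim(3) by linarith
      moreover have "d * (real n - 1) < real (p n)" "real (p n) < (1 - d) * (real n - 1)"
        using elim by (auto simp: field_simps)
      \<comment> \<open>Halving \<open>d\<close> pays for replacing \<open>n - 1\<close> by
        \<open>n\<close>, as \<open>n\<close> is at least 2.\<close>
      moreover have "d / 2 * real n \<le> d * (real n - 1)"
        using elim(3) d(1) by (simp add: field_simps)
      ultimately show ?case by (simp add: algebra_simps min_def)
    qed
  qed
qed

theorem theorem2:
  fixes F :: "complex \<Rightarrow> complex"
    and p q :: "nat \<Rightarrow> nat"
    and r B L :: real
    and z :: "nat \<Rightarrow> nat \<Rightarrow> complex"
  assumes F_cont: "continuous_on unit_circle F"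
    and F_modulus: "modulus_of_continuity F \<in> o[at_right 0](\<lambda>\<delta>. \<delta> powr (1 / 2))"
    and p_mono: "mono_on {1..} p"
    and q_mono: "mono_on {1..} q"
    and pq_sum: "\<And>n. n \<ge> 1 \<Longrightarrow> p n + q n = n - 1"
    and p_lim: "(\<lambda>n. real (p n) / (real n - 1)) \<longlonglongrightarrow> r"
    and r_bounds: "0 < r" "r < 1"
    and nodes_circle: "\<And>n j. j \<in> {1..n} \<Longrightarrow> cmod (z n j) = 1"
    and nodes_distinct: "\<And>n. inj_on (z n) {1..n}"
    and BL_pos: "B > 0" "L > 0"
    and cond_i: "\<forall>\<^sub>F n in sequentially. \<forall>x\<in>unit_circle.
      B \<le> cmod (poly (pderiv (nodal_poly n (z n))) x) / real n"
    and cond_ii: "\<forall>\<^sub>F n in sequentially. \<forall>x\<in>unit_circle.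
      (\<Sum>j = 1..n. (cmod (poly (nodal_poly n (z n) div [:- z n j, 1:]) x))\<^sup>2) / (real n)\<^sup>2 \<le> L"
  shows "uniform_limit unit_circle
    (\<lambda>n. laurent_interpolant (p n) (q n) n (z n) F) F sequentially"
proof (rule uniform_limitI)
  fix \<epsilon> :: real assume \<epsilon>: "\<epsilon> > 0"
  obtain c where c: "c > 0" "\<forall>\<^sub>F n in sequentially. c * real n \<le> real (min (p n) (q n))"
    using eventually_degree_linear[OF pq_sum p_lim r_bounds] by blast
  define A where "A = sqrt (2 / c) * (1 + sqrt L / B)"
  have A: "A > 0" using c BL_pos unfolding A_def by (intro mult_pos_pos add_pos_pos) auto
  \<comment> \<open>The final error will be at most \<open>14 * e * A\<close>, so 15 makes it
    strictly less than the target. Fixing \<open>e\<close> here lets \<open>K\<close> be chosen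
    before \<open>n\<close>.\<close>
  define e where "e = \<epsilon> / (15 * A)"
  have e: "e > 0" using A \<epsilon> by (simp add: e_def)
  obtain K where K: "K \<ge> 0" "\<And>m p q. m \<ge> 1 \<Longrightarrow> 2 * m - 2 \<le> p \<Longrightarrow> 2 * m - 2 \<le> q \<Longrightarrow>
    \<exists>R. degree R \<le> p + q \<and>
      (\<forall>x. cmod x = 1 \<longrightarrow> cmod (x ^ p * F x - poly R x) \<le> (13 * e + 12 * K / real m) / sqrt (real m))"
    using small_modulus_approximation[OF F_cont F_modulus e] by blast
  \<comment> \<open>The threshold for \<open>n\<close> is chosen so that
    \<open>c * n \<le> 2 * m\<close> makes \<open>12 * K / m\<close> at most \<open>e\<close>,
    turning \<open>13 * e\<close> into \<open>14 * e\<close>.\<close>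
  have "filterlim real at_top sequentially" by (rule filterlim_real_sequentially)
  hence "\<forall>\<^sub>F n in sequentially. 24 * K / (c * e) \<le> real n"
    by (simp add: filterlim_at_top)
  with c(2) cond_i cond_ii eventually_ge_at_top[of 1]
  show "\<forall>\<^sub>F n in sequentially. \<forall>x\<in>unit_circle.
      dist (laurent_interpolant (p n) (q n) n (z n) F x) (F x) < \<epsilon>"
  proof eventually_elim
    case (elim n)
    \<comment> \<open>The largest \<open>m\<close> with \<open>2 * m - 2\<close> at most both
      degrees; the added 1 also makes it positive.\<close>
    define m where "m = min (p n) (q n) div 2 + 1"
    have m: "m \<ge> 1" "2 * m - 2 \<le> p n" "2 * m - 2 \<le> q n" by (auto simp: m_def)
    have "min (p n) (q n) \<le> 2 * m" unfolding m_def by presburger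
    hence "real (min (p n) (q n)) \<le> 2 * real m" by linarith
    hence mn: "c * real n \<le> 2 * real m" using elim(1) by linarith
    hence sq: "sqrt (real n) \<le> sqrt (2 / c) * sqrt (real m)"
      using c(1) by (auto simp: field_simps simp flip: real_sqrt_mult)
    have "24 * K \<le> e * (c * real n)" using elim(5) c(1) e by (simp add: field_simps)
    also have "\<dots> \<le> e * (2 * real m)" using mn e by (intro mult_left_mono) auto
    finally have Km: "12 * K / real m \<le> e" using m(1) by (simp add: field_simps)
    obtain R where R: "degree R \<le> p n + q n" "\<And>x. cmod x = 1 \<Longrightarrow>
        cmod (x ^ p n * F x - poly R x) \<le> (13 * e + 12 * K / real m) / sqrt (real m)"
      using K(2)[OF m] by blast
    show ?case
    proof
      fix x :: complex assume x: "x \<in> unit_circle"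
      have "cmod (laurent_interpolant (p n) (q n) n (z n) F x - F x)
          \<le> (13 * e + 12 * K / real m) / sqrt (real m) * sqrt (real n) * (1 + sqrt L / B)"
        by (rule laurent_interpolant_error[OF elim(4) pq_sum[OF elim(4)] BL_pos(1) x _
              nodes_distinct elim(2,3) R]) (auto simp: nodes_circle)
      also have "\<dots> \<le> (14 * e) / sqrt (real m) * (sqrt (2 / c) * sqrt (real m)) * (1 + sqrt L / B)"
        using Km sq BL_pos e K(1) c(1) by (intro mult_mono divide_right_mono add_nonneg_nonneg) auto
      also have "\<dots> = 14 * e * A" using m(1) by (simp add: A_def)
      also have "\<dots> < \<epsilon>" using A \<epsilon> by (simp add: e_def)
      finally show "dist (laurent_interpolant (p n) (q n) n (z n) F x) (F x) < \<epsilon>"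
        by (simp add: dist_norm)
    qed
  qed
qed

end
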